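(* Let $G_1,\ldots,G_n$ be nondeterministic automata, where $G_i$ has set of secret states $Q_i^S$ and non-secret states $Q_i^{NS}=Q_i\setminus Q_i^S$, and consider the composed system $G_1\|\cdots\|G_n$ with interaction $\|_\lor$, i.e. with state set $Q=Q_1\times\cdots\times Q_n$ and set of secret states $Q^S=Q\setminus Q^{NS}$, where $Q^{NS}=Q_1^{NS}\times\cdots\times Q_n^{NS}$. Let $\sim$ be an opaque observation equivalence on $G_1$ and let $\tilde G_1$ be the quotient automaton of $G_1$ modulo $\sim$. Then $G_1\|\cdots\|G_n$ is current-state opaque (with respect to $Q^S$) if and only if $\tilde G_1\|G_2\|\cdots\|G_n$ is current-state opaque (with respect to its secret states, defined in the same $\|_\lor$ manner).
   Context: An automaton is $G=\langle\Sigma_\tau,Q,\to,Q^\circ\rangle$ with finite set $\Sigma$ of observable events, a special unobservable event $\tau\notin\Sigma$, $\Sigma_\tau=\Sigma\cup\{\tau\}$, finite state set $Q$, transition relation $\to\subseteq Q\times\Sigma_\tau\times Q$ and initial states $Q^\circ\subseteq Q$; it also carries a set of secret states $Q^S\subseteq Q$, with $Q^{NS}=Q\setminus Q^S$. Transitions extend to strings; for $s\in\Sigma^*$, $p\stackrel{s}{\Rightarrow}q$ means there is $t\in\Sigma_\tau^*$ such that deleting all $\tau$'s from $t$ gives $s$ and $p\stackrel{t}{\to}q$; $p\stackrel{s}{\Rightarrow}Y$ means $p\stackrel{s}{\Rightarrow}q$ for some $q\in Y$; $L(G,q)=\{s\in\Sigma^*: q\stackrel{s}{\Rightarrow}q'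 \text{ for some } q'\}$. Synchronous composition of $G_1=\langle\Sigma_{1,\tau},Q_1,\to_1,Q_1^\circ\rangle$ and $G_2=\langle\Sigma_{2,\tau},Q_2,\to_2,Q_2^\circ\rangle$: event set $\Sigma_1\cup\Sigma_2$ (plus $\tau$), states $Q_1\times Q_2$, initial states $Q_1^\circ\times Q_2^\circ$ (marked states, if present, $Q_1^m\times Q_2^m$), and transitions $(x_1,x_2)\stackrel{\sigma}{\to}(y_1,y_2)$ if $\sigma\in\Sigma_1\cap\Sigma_2$, $x_1\stackrel{\sigma}{\to}_1y_1$, $x_2\stackrel{\sigma}{\to}_2y_2$; $(x_1,x_2)\stackrel{\sigma}{\to}(y_1,x_2)$ if $\sigma\in(\Sigma_1\setminus\Sigma_2)\cup\{\tau\}$ and $x_1\stackrel{\sigma}{\to}_1y_1$; $(x_1,x_2)\stackrel{\sigma}{\to}(x_1,y_2)$ if $\sigma\in(\Sigma_2\setminus\Sigma_1)\cup\{\tau\}$ and $x_2\stackrel{\sigma}{\to}_2y_2$. Iterated compositions are formed in the same way. Current-state opacity: $G$ is current-state opaque w.r.t. $Q^S$ iff for every $q^\circ\in Q^\circ$ and every $s\in L(G,q^\circ)$ with $q^\circ\stackrel{s}{\Rightarrow}Q^S$, there exists $q'^\circ\in Q^\circ$ with $q'^\circ\stackrel{s}{\Rightarrow}Q^{NS}$. Opaque observation equivalence: an equivalence relation $\sim$ on $Q$ such that whenever $x_1\sim x_2$: (i) if $x_1\stackrel{s}{\Rightarrow}y_1$ for some $s\in\Sigma^*$, then there is $y_2$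 with $x_2\stackrel{s}{\Rightarrow}y_2$ and $y_1\sim y_2$; (ii) $x_1\in Q^S$ iff $x_2\in Q^S$. Quotient automaton of $G$ modulo $\sim$: $\tilde G=\langle\Sigma_\tau,\tilde Q,\to/\!\sim,\tilde Q^\circ\rangle$, where $\tilde Q$ is the set of equivalence classes $[x]$, $([x],\sigma,[y])\in\to/\!\sim$ iff $x'\stackrel{\sigma}{\to}y'$ for some $x'\in[x]$, $y'\in[y]$, and $\tilde Q^\circ=\{[x^\circ]:x^\circ\in Q^\circ\}$; a class $[x]$ is secret iff $x\in Q^S$ (well defined by (ii)). *)

theory Defs
  imports Main
begin

text \<open>
  The unobservable event \<open>\<tau>\<close> is \<^term>\<open>None\<close>; an observable event \<open>\<sigma>\<close> is \<open>Some \<sigma>\<close>.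
\<close>

record ('q, 'e) automaton =
  alphabet :: "'e set"
  states :: "'q set"
  transitions :: "('q \<times> 'e option \<times> 'q) set"
  initial :: "'q set"

record ('q, 'e) secret_automaton = "('q, 'e) automaton" +
  secret :: "'q set"

definition events_tau :: "('q, 'e, 'z) automaton_scheme \<Rightarrow> 'e option set" where
  "events_tau G = insert None (Some ` alphabet G)"

definition automaton :: "('q, 'e, 'z) automaton_scheme \<Rightarrow> bool" where
  "automaton G \<longleftrightarrow>
     finite (alphabet G) \<and> finite (states G) \<and>
     transitions G \<subseteq> states G \<times> events_tau G \<times> states G \<and>
     initial G \<subseteq> states G"

definition secret_automaton :: "('q, 'e, 'z) secret_automaton_scheme \<Rightarrow> bool" where
  "secret_automaton G \<longleftrightarrow> automaton G \<and> secret G \<subseteq> states G"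

definition nonsecret :: "('q, 'e, 'z) secret_automaton_scheme \<Rightarrow> 'q set" where
  "nonsecret G = states G - secret G"

fun steps :: "('q, 'e, 'z) automaton_scheme \<Rightarrow> 'q \<Rightarrow> 'e option list \<Rightarrow> 'q \<Rightarrow> bool" where
  "steps G p [] q \<longleftrightarrow> p = q"
| "steps G p (a # t) q \<longleftrightarrow> (\<exists>p'. (p, a, p') \<in> transitions G \<and> steps G p' t q)"

definition delete_tau :: "'e option list \<Rightarrow> 'e list" where
  "delete_tau t = map the (filter (\<lambda>a. a \<noteq> None) t)"

definition weak_steps :: "('q, 'e, 'z) automaton_scheme \<Rightarrow> 'q \<Rightarrow> 'e list \<Rightarrow> 'q \<Rightarrow> bool" where
  "weak_steps G p s q \<longleftrightarrow> (\<exists>t \<in> lists (events_tau G). delete_tau t = s \<and> steps G p t q)"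

definition language :: "('q, 'e, 'z) automaton_scheme \<Rightarrow> 'q \<Rightarrow> 'e list set" where
  "language G q = {s \<in> lists (alphabet G). \<exists>q' \<in> states G. weak_steps G q s q'}"

definition current_state_opaque :: "('q, 'e, 'z) automaton_scheme \<Rightarrow> 'q set \<Rightarrow> bool" where
  "current_state_opaque G S \<longleftrightarrow>
     (\<forall>q0 \<in> initial G. \<forall>s \<in> language G q0.
        (\<exists>q \<in> S. weak_steps G q0 s q) \<longrightarrow>
        (\<exists>q0' \<in> initial G. \<exists>q \<in> states G - S. weak_steps G q0' s q))"

definition sync ::
  "('a, 'e, 'y) automaton_scheme \<Rightarrow> ('b, 'e, 'z) automaton_scheme \<Rightarrow> ('a \<times> 'b, 'e) automaton" where
  "sync G H =
     \<lparr>alphabet = alphabet G \<union> alphabet H,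
      states = states G \<times> states H,
      transitions =
        {((x1, x2), Some \<sigma>, (y1, y2)) | x1 x2 \<sigma> y1 y2.
           \<sigma> \<in> alphabet G \<inter> alphabet H \<and> (x1, Some \<sigma>, y1) \<in> transitions G \<and> (x2, Some \<sigma>, y2) \<in> transitions H} \<union>
        {((x1, x2), a, (y1, x2)) | x1 x2 a y1.
           a \<in> Some ` (alphabet G - alphabet H) \<union> {None} \<and> (x1, a, y1) \<in> transitions G \<and> x2 \<in> states H} \<union>
        {((x1, x2), a, (x1, y2)) | x1 x2 a y2.
           a \<in> Some ` (alphabet H - alphabet G) \<union> {None} \<and> (x2, a, y2) \<in> transitions H \<and> x1 \<in> states G},
      initial = initial G \<times> initial H\<rparr>"

definition relabel :: "('a \<Rightarrow> 'b) \<Rightarrow> ('a, 'e, 'z) automaton_scheme \<Rightarrow> ('b, 'e) automaton" where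
  "relabel f G =
     \<lparr>alphabet = alphabet G,
      states = f ` states G,
      transitions = {(f x, a, f y) | x a y. (x, a, y) \<in> transitions G},
      initial = f ` initial G\<rparr>"

text \<open>
  \<open>sync_list G [H\<^sub>2, \<dots>, H\<^sub>n]\<close> is \<open>(\<dots>(G \<parallel> H\<^sub>2) \<parallel> \<dots>) \<parallel> H\<^sub>n\<close>, where the nested pair
  \<open>(\<dots>(q\<^sub>1, q\<^sub>2), \<dots>, q\<^sub>n)\<close> is written as \<open>(q\<^sub>1, [q\<^sub>2, \<dots>, q\<^sub>n])\<close> so that all \<open>n\<close> share one state
  type. The first component has its own state type because the quotient lives on
  sets of states.
\<close>

definition sync_list ::
  "('a, 'e, 'y) automaton_scheme \<Rightarrow> ('b, 'e, 'z) automaton_scheme list \<Rightarrow> ('a \<times> 'b list, 'e) automaton" where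
  "sync_list G Hs =
     foldl (\<lambda>A H. relabel (\<lambda>((q, qs), p). (q, qs @ [p])) (sync A H)) (relabel (\<lambda>q. (q, [])) G) Hs"

definition secret_or ::
  "('a, 'e, 'y) secret_automaton_scheme \<Rightarrow> ('b, 'e, 'z) secret_automaton_scheme list \<Rightarrow> ('a \<times> 'b list) set" where
  "secret_or G Hs = states (sync_list G Hs) - nonsecret G \<times> listset (map nonsecret Hs)"

definition opaque_observation_equivalence ::
  "('q, 'e, 'z) secret_automaton_scheme \<Rightarrow> ('q \<times> 'q) set \<Rightarrow> bool" where
  "opaque_observation_equivalence G r \<longleftrightarrow>
     equiv (states G) r \<and>
     (\<forall>(x1, x2) \<in> r.
        (\<forall>s \<in> lists (alphabet G). \<forall>y1. weak_steps G x1 s y1 \<longrightarrow>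
           (\<exists>y2. weak_steps G x2 s y2 \<and> (y1, y2) \<in> r)) \<and>
        (x1 \<in> secret G \<longleftrightarrow> x2 \<in> secret G))"

definition quotient_automaton ::
  "('q, 'e, 'z) secret_automaton_scheme \<Rightarrow> ('q \<times> 'q) set \<Rightarrow> ('q set, 'e) secret_automaton" where
  "quotient_automaton G r =
     \<lparr>alphabet = alphabet G,
      states = states G // r,
      transitions = {(X, a, Y). X \<in> states G // r \<and> Y \<in> states G // r \<and>
                 (\<exists>x \<in> X. \<exists>y \<in> Y. (x, a, y) \<in> transitions G)},
      initial = {r `` {x} | x. x \<in> initial G},
      secret = {r `` {x} | x. x \<in> secret G}\<rparr>"

lemma listset_snoc: "listset (As @ [A]) = {xs @ [x] | xs x. xs \<in> listset As \<and> x \<in> A}"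
proof (induction As)
  case Nil
  show ?case by (auto simp: set_Cons_def)
next
  case (Cons B As)
  have "listset ((B # As) @ [A]) = {b # xs @ [x] | b xs x. b \<in> B \<and> xs \<in> listset As \<and> x \<in> A}"
    using Cons.IH by (auto simp: set_Cons_def)
  also have "\<dots> = {ys @ [x] | ys x. ys \<in> listset (B # As) \<and> x \<in> A}"
    by (force simp: set_Cons_def)
  finally show ?case .
qed

lemma states_sync_list: "states (sync_list G Hs) = states G \<times> listset (map states Hs)"
proof (induction Hs rule: rev_induct)
  case Nil
  show ?case by (auto simp: sync_list_def relabel_def)
next
  case (snoc H Hs)
  have "states (sync_list G (Hs @ [H])) =
      (\<lambda>((q, qs), p). (q, qs @ [p])) ` (states (sync_list G Hs) \<times> states H)"
    by (simp add: sync_list_def relabel_def sync_def)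
  also have "\<dots> = states G \<times> listset (map states Hs @ [states H])"
    unfolding snoc.IH listset_snoc by force
  finally show ?case by simp
qed

end

theory Submission
  imports Defs
begin

text \<open>
  The graph of \<open>x \<mapsto> [x]\<close> is a weak bisimulation between \<open>G\<^sub>1\<close> and its quotient. Weak simulations
  survive synchronisation with a further automaton: a weak step of one component that carries at
  most one observable event can be replayed in the composition, the partner either staying
  put or moving exactly when that event occurs. Hence the two composed systems are weakly
  bisimilar by a relation that matches initial states with initial states and, by condition (ii),
  secret states with secret states; opacity is invariant under such a bisimulation.
\<close>

text \<open>Only single transitions on the left are matched, so closure under each operation can be
  checked transition by transition; \<open>delete_tau [a]\<close> covers \<open>\<tau>\<close> and
  observable events at once. Equal alphabets keep shared events shared when \<open>A\<close> is
  replaced by \<open>B\<close>, and the bound on \<open>R\<close> supplies the state memberships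
  that \<open>sync\<close> demands of an idle component.\<close>

definition weak_simulation ::
  "('p, 'e, 'y) automaton_scheme \<Rightarrow> ('q, 'e, 'z) automaton_scheme \<Rightarrow> ('p \<times> 'q) set \<Rightarrow> bool" where
  "weak_simulation A B R \<longleftrightarrow>
     alphabet A = alphabet B \<and> R \<subseteq> states A \<times> states B \<and>
     (\<forall>p q a p'. (p, q) \<in> R \<longrightarrow> (p, a, p') \<in> transitions A \<longrightarrow>
        (\<exists>q'. weak_steps B q (delete_tau [a]) q' \<and> (p', q') \<in> R))"

section \<open>Weak steps, and what a weak simulation transfers\<close>

lemma delete_tau_simps [simp]:
  "delete_tau [] = []"
  "delete_tau (None # t) = delete_tau t"
  "delete_tau (Some \<sigma> # t) = \<sigma> # delete_tau t"
  by (simp_all add: delete_tau_def)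

lemma delete_tau_append: "delete_tau (t @ u) = delete_tau t @ delete_tau u"
  by (simp add: delete_tau_def)

lemma steps_append: "steps G p (t @ u) q \<longleftrightarrow> (\<exists>p'. steps G p t p' \<and> steps G p' u q)"
  by (induction t arbitrary: p) auto

lemma weak_steps_Nil: "weak_steps G p [] p"
  unfolding weak_steps_def by (rule bexI[of _ "[]"]) auto

lemma weak_steps_append:
  assumes "weak_steps G p s p'" and "weak_steps G p' s' q"
  shows "weak_steps G p (s @ s') q"
proof -
  obtain t u where "t \<in> lists (events_tau G)" "delete_tau t = s" "steps G p t p'"
      "u \<in> lists (events_tau G)" "delete_tau u = s'" "steps G p' u q"
    using assms unfolding weak_steps_def by blast
  then show ?thesis
    unfolding weak_steps_def
    by (intro bexI[of _ "t @ u"]) (auto simp: delete_tau_append steps_append)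
qed

lemma weak_steps_single:
  assumes "automaton G" and "(p, a, q) \<in> transitions G"
  shows "weak_steps G p (delete_tau [a]) q"
  using assms unfolding weak_steps_def automaton_def by (intro bexI[of _ "[a]"]) auto

text \<open>The weak steps that answer the successive transitions of a run are concatenated; each
  ends in a related pair, from which the next one starts.\<close>

lemma weak_simulation_weak_steps:
  assumes sim: "weak_simulation A B R" and "(p, q) \<in> R" and "weak_steps A p s p'"
  shows "\<exists>q'. weak_steps B q s q' \<and> (p', q') \<in> R"
proof -
  obtain t where t: "delete_tau t = s" "steps A p t p'"
    using assms(3) unfolding weak_steps_def by blast
  have "\<exists>q'. weak_steps B q (delete_tau t) q' \<and> (p', q') \<in> R"
    using t(2) \<open>(p, q) \<in> R\<close>
  proof (induction t arbitrary: p q)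
    case Nil
    then show ?case by (auto intro: weak_steps_Nil)
  next
    case (Cons a t)
    then obtain p1 where "(p, a, p1) \<in> transitions A" "steps A p1 t p'" by auto
    then obtain q1 where q1: "weak_steps B q (delete_tau [a]) q1" "(p1, q1) \<in> R"
      using sim Cons.prems unfolding weak_simulation_def by blast
    then obtain q' where "weak_steps B q1 (delete_tau t) q'" "(p', q') \<in> R"
      using Cons.IH \<open>steps A p1 t p'\<close> by blast
    moreover have "delete_tau (a # t) = delete_tau [a] @ delete_tau t"
      using delete_tau_append[of "[a]" t] by simp
    ultimately show ?case
      using weak_steps_append[OF q1(1)] by auto
  qed
  then show ?thesis using t(1) by simp
qed

text \<open>A secret run of \<open>B\<close> is pulled back to a secret run of \<open>A\<close>,
  opacity of \<open>A\<close> yields a nonsecret run on the same string, and this run is pushed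
  forward to \<open>B\<close>. Using one relation in both directions lets a single agreement
  condition on \<open>S\<close> and \<open>T\<close> serve for both moves.\<close>

lemma current_state_opaque_transfer:
  assumes fwd: "weak_simulation A B R" and bwd: "weak_simulation B A (R\<inverse>)"
    and init_fwd: "\<And>p. p \<in> initial A \<Longrightarrow> \<exists>q \<in> initial B. (p, q) \<in> R"
    and init_bwd: "\<And>q. q \<in> initial B \<Longrightarrow> \<exists>p \<in> initial A. (p, q) \<in> R"
    and secrets: "\<And>p q. (p, q) \<in> R \<Longrightarrow> p \<in> S \<longleftrightarrow> q \<in> T"
    and opaque: "current_state_opaque A S"
  shows "current_state_opaque B T"
  unfolding current_state_opaque_def
proof (intro ballI impI)
  fix q0 s
  assume q0: "q0 \<in> initial B" and s: "s \<in> language B q0"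
    and "\<exists>q \<in> T. weak_steps B q0 s q"
  then obtain q where q: "q \<in> T" "weak_steps B q0 s q" by blast
  obtain p0 where p0: "p0 \<in> initial A" "(p0, q0) \<in> R" using init_bwd q0 by blast
  obtain p where p: "weak_steps A p0 s p" "(p, q) \<in> R"
    using weak_simulation_weak_steps[OF bwd, of q0 p0 s q] p0 q by auto
  \<comment> \<open>The alphabets agree, and \<open>p\<close> is a state of \<open>A\<close> because
    \<open>R\<close> relates states only.\<close>
  have "s \<in> language A p0"
    using s p fwd unfolding language_def weak_simulation_def by auto
  moreover have "p \<in> S" using secrets p q by blast
  ultimately obtain p0' p' where p': "p0' \<in> initial A" "p' \<in> states A - S" "weak_steps A p0' s p'"
    using opaque p0(1) p(1) unfolding current_state_opaque_def by blast
  obtain q0' where q0': "q0' \<in> initial B" "(p0', q0') \<in> R" using init_fwd p' by blast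
  obtain q' where q': "weak_steps B q0' s q'" "(p', q') \<in> R"
    using weak_simulation_weak_steps[OF fwd q0'(2) p'(3)] by blast
  have "q' \<in> states B - T"
    using q'(2) p'(2) secrets fwd unfolding weak_simulation_def by blast
  then show "\<exists>q0' \<in> initial B. \<exists>q \<in> states B - T. weak_steps B q0' s q"
    using q0' q' by blast
qed

section \<open>Weak simulations under synchronisation\<close>

lemma steps_sync_left:
  assumes "steps B x t y" and "z \<in> states H"
    and "set t \<subseteq> events_tau B" and "set (delete_tau t) \<inter> alphabet H = {}"
  shows "steps (sync B H) (x, z) t (y, z)"
  using assms
proof (induction t arbitrary: x)
  case (Cons a t)
  then obtain x' where x': "(x, a, x') \<in> transitions B" "steps B x' t y" by auto
  \<comment> \<open>The event \<open>a\<close> is \<open>\<tau>\<close> or private to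
    \<open>B\<close>, so \<open>H\<close> may idle at \<open>z\<close>.\<close>
  have "((x, z), a, (x', z)) \<in> transitions (sync B H)"
    using x'(1) Cons.prems by (cases a) (auto simp: sync_def events_tau_def)
  moreover have "steps (sync B H) (x', z) t (y, z)"
    using x'(2) Cons by (cases a) auto
  ultimately show ?case by auto
qed auto

text \<open>The partner \<open>H\<close> idles at \<open>z\<close> during the \<open>\<tau>\<close>
  steps before \<open>\<sigma>\<close>, moves to \<open>z'\<close> together with
  \<open>\<sigma>\<close>, and idles at \<open>z'\<close> during the \<open>\<tau>\<close> steps
  after it.\<close>

lemma steps_sync_shared:
  assumes "steps B x t y" and "(z, Some \<sigma>, z') \<in> transitions H" and "automaton H"
    and "set t \<subseteq> events_tau B" and "delete_tau t = [\<sigma>]"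
  shows "steps (sync B H) (x, z) t (y, z')"
  using assms
proof (induction t arbitrary: x)
  case (Cons a t)
  then obtain x' where x': "(x, a, x') \<in> transitions B" "steps B x' t y" by auto
  have z: "z \<in> states H" "z' \<in> states H" "\<sigma> \<in> alphabet H"
    using Cons.prems(2,3) by (auto simp: automaton_def events_tau_def)
  show ?case
  proof (cases a)
    case None
    have "((x, z), a, (x', z)) \<in> transitions (sync B H)"
      using x'(1) z None by (auto simp: sync_def)
    moreover have "steps (sync B H) (x', z) t (y, z')"
      using x'(2) Cons None by auto
    ultimately show ?thesis by auto
  next
    case (Some \<sigma>')
    then have "((x, z), a, (x', z')) \<in> transitions (sync B H)"
      using x'(1) z Cons.prems by (auto simp: sync_def events_tau_def)
    \<comment> \<open>The single observable event has been consumed, so \<open>delete_tau t\<close>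
      is empty and \<open>H\<close> can idle for the rest of the run.\<close>
    moreover have "steps (sync B H) (x', z') t (y, z')"
      using steps_sync_left[OF x'(2) z(2)] Cons.prems Some by auto
    ultimately show ?thesis by auto
  qed
qed auto

lemma events_tau_sync: "events_tau (sync B H) = events_tau B \<union> events_tau H"
  by (auto simp: events_tau_def sync_def)

lemma weak_steps_sync_left:
  assumes "weak_steps B x s y" and "z \<in> states H" and "set s \<inter> alphabet H = {}"
  shows "weak_steps (sync B H) (x, z) s (y, z)"
  using assms steps_sync_left[of B x _ y z H]
  unfolding weak_steps_def events_tau_sync lists_eq_set by blast

lemma weak_steps_sync_shared:
  assumes "weak_steps B x [\<sigma>] y" and "(z, Some \<sigma>, z') \<in> transitions H" and "automaton H"
  shows "weak_steps (sync B H) (x, z) [\<sigma>] (y, z')"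
  using assms steps_sync_shared[of B x _ y z \<sigma> z' H]
  unfolding weak_steps_def events_tau_sync lists_eq_set by blast

text \<open>The three kinds of transition of the composition are answered separately. A shared event
  is answered by a weak step of \<open>B\<close> during which \<open>H\<close> moves once, a move of
  \<open>A\<close> alone by a weak step of \<open>B\<close> with \<open>H\<close> idle, and a move
  of \<open>H\<close> alone by the same move with \<open>y\<close> at rest.\<close>

lemma weak_simulation_sync:
  assumes sim: "weak_simulation A B R" and H: "automaton H"
  shows "weak_simulation (sync A H) (sync B H) {((x, z), (y, z)) | x y z. (x, y) \<in> R \<and> z \<in> states H}"
    (is "weak_simulation _ _ ?R")
proof -
  have alph: "alphabet A = alphabet B" and R: "R \<subseteq> states A \<times> states B"
    and step: "\<And>p q a p'. (p, q) \<in> R \<Longrightarrow> (p, a, p') \<in> transitions A \<Longrightarrow>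
        \<exists>q'. weak_steps B q (delete_tau [a]) q' \<and> (p', q') \<in> R"
    using sim unfolding weak_simulation_def by blast+
  have "\<exists>q'. weak_steps (sync B H) (y, z) (delete_tau [a]) q' \<and> (p', q') \<in> ?R"
    if xy: "(x, y) \<in> R" and z: "z \<in> states H" and tr: "((x, z), a, p') \<in> transitions (sync A H)"
    for x y z a p'
  proof -
    obtain x' z' where p': "p' = (x', z')" by fastforce
    from tr consider
        (shared) \<sigma> where "a = Some \<sigma>" "(x, a, x') \<in> transitions A" "(z, a, z') \<in> transitions H"
      | (left) "a \<in> Some ` (alphabet A - alphabet H) \<union> {None}" "(x, a, x') \<in> transitions A" "z' = z"
      | (right) "a \<in> Some ` (alphabet H - alphabet A) \<union> {None}" "(z, a, z') \<in> transitions H" "x' = x"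
      unfolding sync_def p' by auto
    then show ?thesis
    proof cases
      case shared
      then obtain y' where y': "weak_steps B y [\<sigma>] y'" "(x', y') \<in> R"
        using step[OF xy] by fastforce
      moreover have "z' \<in> states H" using shared H by (auto simp: automaton_def)
      ultimately show ?thesis
        using weak_steps_sync_shared[OF y'(1) _ H] shared p' by auto
    next
      case left
      then obtain y' where y': "weak_steps B y (delete_tau [a]) y'" "(x', y') \<in> R"
        using step[OF xy] by blast
      moreover have "set (delete_tau [a]) \<inter> alphabet H = {}" using left by auto
      ultimately show ?thesis
        using weak_steps_sync_left[OF y'(1) z] left p' z by auto
    next
      case right
      have y: "y \<in> states B" using xy R by blast
      have ev: "a \<in> events_tau (sync B H)" and z': "z' \<in> states H"
        using right H by (auto simp: automaton_def events_tau_sync)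
      \<comment> \<open>An event private to \<open>H\<close> beside \<open>A\<close> is also private
        to \<open>H\<close> beside \<open>B\<close>, since the alphabets of \<open>A\<close> and
        \<open>B\<close> coincide.\<close>
      have "((y, z), a, (y, z')) \<in> transitions (sync B H)"
        using right y alph by (auto simp: sync_def)
      then have "weak_steps (sync B H) (y, z) (delete_tau [a]) (y, z')"
        unfolding weak_steps_def using ev by (intro bexI[of _ "[a]"]) auto
      then show ?thesis using right p' xy z' by auto
    qed
  qed
  moreover have "alphabet (sync A H) = alphabet (sync B H)" using alph by (simp add: sync_def)
  moreover have "?R \<subseteq> states (sync A H) \<times> states (sync B H)" using R by (auto simp: sync_def)
  ultimately show ?thesis unfolding weak_simulation_def by blast
qed

section \<open>Relabelling and iterated composition\<close>

lemma steps_relabel: "steps G p t q \<Longrightarrow> steps (relabel f G) (f p) t (f q)"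
  by (induction t arbitrary: p) (auto simp: relabel_def)

lemma weak_steps_relabel: "weak_steps G p s q \<Longrightarrow> weak_steps (relabel f G) (f p) s (f q)"
  unfolding weak_steps_def using steps_relabel[of G p _ q f]
  by (auto simp: events_tau_def relabel_def)

text \<open>By injectivity of \<open>f\<close>, a transition leaving \<open>f p\<close> comes from
  one leaving \<open>p\<close> itself, and not from another state with the same image.\<close>

lemma weak_simulation_relabel:
  assumes sim: "weak_simulation A B R" and "inj f"
  shows "weak_simulation (relabel f A) (relabel g B) (map_prod f g ` R)"
proof -
  have "\<exists>q'. weak_steps (relabel g B) (g q) (delete_tau [a]) q' \<and> (p', q') \<in> map_prod f g ` R"
    if pq: "(p, q) \<in> R" and tr: "(f p, a, p') \<in> transitions (relabel f A)" for p q a p'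
  proof -
    obtain p1 where p1: "p' = f p1" "(p, a, p1) \<in> transitions A"
      using tr \<open>inj f\<close> by (auto simp: relabel_def dest: injD)
    then obtain q1 where "weak_steps B q (delete_tau [a]) q1" "(p1, q1) \<in> R"
      using sim pq unfolding weak_simulation_def by blast
    then show ?thesis using weak_steps_relabel[of B q _ q1 g] p1 by force
  qed
  moreover have "alphabet (relabel f A) = alphabet (relabel g B)"
    and "map_prod f g ` R \<subseteq> states (relabel f A) \<times> states (relabel g B)"
    using sim by (auto simp: weak_simulation_def relabel_def)
  ultimately show ?thesis unfolding weak_simulation_def by auto
qed

definition lift_relation ::
  "('p \<times> 'q) set \<Rightarrow> ('b, 'e, 'z) automaton_scheme list \<Rightarrow> (('p \<times> 'b list) \<times> ('q \<times> 'b list)) set" where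
  "lift_relation R Hs = {((x, zs), (y, zs)) | x y zs. (x, y) \<in> R \<and> zs \<in> listset (map states Hs)}"

lemma lift_relation_converse: "lift_relation (R\<inverse>) Hs = (lift_relation R Hs)\<inverse>"
  by (auto simp: lift_relation_def)

lemma sync_list_Nil: "sync_list G [] = relabel (\<lambda>q. (q, [])) G"
  by (simp add: sync_list_def)

lemma sync_list_snoc:
  "sync_list G (Hs @ [H]) = relabel (\<lambda>((q, qs), p). (q, qs @ [p])) (sync (sync_list G Hs) H)"
  by (simp add: sync_list_def)

text \<open>The composition is a left fold, so the list is extended at its end: each new component
  adds one synchronisation followed by one injective relabelling, and both preserve weak
  simulations.\<close>

lemma weak_simulation_sync_list:
  fixes Hs :: "('b, 'e, 'z) automaton_scheme list"
  assumes sim: "weak_simulation A B R" and "\<And>H. H \<in> set Hs \<Longrightarrow> automaton H"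
  shows "weak_simulation (sync_list A Hs) (sync_list B Hs) (lift_relation R Hs)"
  using assms(2)
proof (induction Hs rule: rev_induct)
  case Nil
  have "lift_relation R ([] :: ('b, 'e, 'z) automaton_scheme list) = map_prod (\<lambda>q. (q, [])) (\<lambda>q. (q, [])) ` R"
    by (force simp: lift_relation_def)
  then show ?case
    unfolding sync_list_Nil by (simp add: weak_simulation_relabel[OF sim] inj_on_def)
next
  case (snoc H Hs)
  let ?f = "\<lambda>((q, qs), p). (q, qs @ [p])"
  let ?R = "{((x, z), (y, z)) | x y z. (x, y) \<in> lift_relation R Hs \<and> z \<in> states H}"
  have "weak_simulation (sync (sync_list A Hs) H) (sync (sync_list B Hs) H) ?R"
    using snoc by (intro weak_simulation_sync) auto
  \<comment> \<open>Flattening the nested pairs turns the relation obtained from synchronisation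
    with \<open>H\<close> into the lifted relation for the longer list.\<close>
  moreover have "lift_relation R (Hs @ [H]) = map_prod ?f ?f ` ?R"
  proof (intro equalityI subsetI)
    fix w assume "w \<in> lift_relation R (Hs @ [H])"
    then obtain x y zs z where "(x, y) \<in> R" "zs \<in> listset (map states Hs)" "z \<in> states H"
        "w = ((x, zs @ [z]), (y, zs @ [z]))"
      unfolding lift_relation_def map_append list.map listset_snoc by blast
    then have "(((x, zs), z), ((y, zs), z)) \<in> ?R"
        "w = map_prod ?f ?f (((x, zs), z), ((y, zs), z))"
      by (auto simp: lift_relation_def)
    then show "w \<in> map_prod ?f ?f ` ?R" by (metis (no_types, lifting) image_eqI)
  next
    fix w assume "w \<in> map_prod ?f ?f ` ?R"
    then show "w \<in> lift_relation R (Hs @ [H])"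
      by (auto simp: lift_relation_def listset_snoc)
  qed
  ultimately show ?case
    unfolding sync_list_snoc by (simp only:) (rule weak_simulation_relabel, auto simp: inj_on_def)
qed

lemma initial_sync_list: "initial (sync_list G Hs) = initial G \<times> listset (map initial Hs)"
proof (induction Hs rule: rev_induct)
  case Nil
  show ?case by (auto simp: sync_list_Nil relabel_def)
next
  case (snoc H Hs)
  have "initial (sync_list G (Hs @ [H])) =
      (\<lambda>((q, qs), p). (q, qs @ [p])) ` (initial (sync_list G Hs) \<times> initial H)"
    by (simp add: sync_list_snoc relabel_def sync_def)
  also have "\<dots> = initial G \<times> listset (map initial Hs @ [initial H])"
    unfolding snoc.IH listset_snoc by force
  finally show ?case by simp
qed

lemma listset_map_mono:
  assumes "\<And>x. x \<in> set xs \<Longrightarrow> f x \<subseteq> g x"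
  shows "listset (map f xs) \<subseteq> listset (map g xs)"
  using assms
proof (induction xs)
  case (Cons x xs)
  then have "f x \<subseteq> g x" "listset (map f xs) \<subseteq> listset (map g xs)" by auto
  then show ?case by (auto simp: set_Cons_def)
qed simp

section \<open>The quotient automaton\<close>

definition class_graph :: "'a set \<Rightarrow> ('a \<times> 'a) set \<Rightarrow> ('a \<times> 'a set) set" where
  "class_graph A r = {(x, r `` {x}) | x. x \<in> A}"

lemma automaton_quotient:
  assumes "automaton G" and "equiv (states G) r"
  shows "automaton (quotient_automaton G r)"
proof -
  have "finite (states G // r)"
    using assms finite_quotient by (auto simp: automaton_def equiv_def)
  then show ?thesis
    using assms unfolding automaton_def quotient_automaton_def events_tau_def
    by (auto simp: quotientI)
qed

text \<open>A transition of \<open>G\<close> itself witnesses the transition between the classes of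
  its endpoints, so the answer is a single step.\<close>

lemma weak_simulation_quotient:
  assumes G: "automaton G" and eq: "equiv (states G) r"
  shows "weak_simulation G (quotient_automaton G r) (class_graph (states G) r)"
proof -
  have "\<exists>q'. weak_steps (quotient_automaton G r) q (delete_tau [a]) q' \<and>
      (p', q') \<in> class_graph (states G) r"
    if pq: "(p, q) \<in> class_graph (states G) r" and tr: "(p, a, p') \<in> transitions G" for p q a p'
  proof -
    have p: "p \<in> states G" "q = r `` {p}" and p': "p' \<in> states G"
      using pq tr G by (auto simp: class_graph_def automaton_def)
    have "(q, a, r `` {p'}) \<in> transitions (quotient_automaton G r)"
      using p p' tr equiv_class_self[OF eq] by (auto simp: quotient_automaton_def quotientI)
    then show ?thesis
      using weak_steps_single[OF automaton_quotient[OF G eq]] p'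
      by (auto simp: class_graph_def)
  qed
  moreover have "alphabet G = alphabet (quotient_automaton G r)"
    and "class_graph (states G) r \<subseteq> states G \<times> states (quotient_automaton G r)"
    by (auto simp: quotient_automaton_def class_graph_def quotientI)
  ultimately show ?thesis unfolding weak_simulation_def by blast
qed

text \<open>A transition from \<open>X\<close> to \<open>Y\<close> is witnessed by some
  \<open>x1\<close> in \<open>X\<close>, while the answer must start at the given \<open>x\<close>
  in \<open>X\<close>. Condition (i) carries the step over from \<open>x1\<close> to
  \<open>x\<close>, with an endpoint that still lies in \<open>Y\<close>.\<close>

lemma weak_simulation_quotient_converse:
  assumes G: "automaton G" and ooe: "opaque_observation_equivalence G r"
  shows "weak_simulation (quotient_automaton G r) G ((class_graph (states G) r)\<inverse>)"
proof -
  have eq: "equiv (states G) r" using ooe by (simp add: opaque_observation_equivalence_def)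
  have "\<exists>q'. weak_steps G x (delete_tau [a]) q' \<and> (Y, q') \<in> (class_graph (states G) r)\<inverse>"
    if xX: "(x, X) \<in> class_graph (states G) r"
      and tr: "(X, a, Y) \<in> transitions (quotient_automaton G r)" for x X a Y
  proof -
    have X: "X = r `` {x}" using xX by (auto simp: class_graph_def)
    obtain x1 y1 where 1: "x1 \<in> X" "y1 \<in> Y" "(x1, a, y1) \<in> transitions G" "Y \<in> states G // r"
      using tr by (auto simp: quotient_automaton_def)
    have "(x1, x) \<in> r" using 1 X eq by (auto simp: equiv_def dest: symD)
    \<comment> \<open>Condition (i) speaks only of strings over the alphabet.\<close>
    moreover have "delete_tau [a] \<in> lists (alphabet G)"
      using 1 G by (cases a) (auto simp: automaton_def events_tau_def)
    ultimately obtain y where y: "weak_steps G x (delete_tau [a]) y" "(y1, y) \<in> r"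
      using ooe weak_steps_single[OF G 1(3)]
      unfolding opaque_observation_equivalence_def by blast
    have "y \<in> states G" using y(2) eq by (auto simp: equiv_def refl_on_def)
    moreover have "Y = r `` {y}"
    proof -
      obtain w where w: "Y = r `` {w}" using 1(4) by (rule quotientE)
      then have "(w, y1) \<in> r" using 1(2) by simp
      then have "(w, y) \<in> r" using y(2) eq by (meson equivE transD)
      then show ?thesis using w equiv_class_eq[OF eq] by simp
    qed
    ultimately show ?thesis using y(1) by (auto simp: class_graph_def)
  qed
  moreover have "alphabet (quotient_automaton G r) = alphabet G"
    and "(class_graph (states G) r)\<inverse> \<subseteq> states (quotient_automaton G r) \<times> states G"
    by (auto simp: quotient_automaton_def class_graph_def quotientI)
  ultimately show ?thesis unfolding weak_simulation_def by blast
qed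

text \<open>A class counts as secret as soon as it is the class of some secret state
  \<open>x'\<close>, possibly different from \<open>x\<close>; condition (ii) then makes
  \<open>x\<close> secret too.\<close>

lemma nonsecret_quotient_iff:
  assumes ooe: "opaque_observation_equivalence G r" and x: "x \<in> states G"
  shows "r `` {x} \<in> nonsecret (quotient_automaton G r) \<longleftrightarrow> x \<in> nonsecret G"
proof -
  have eq: "equiv (states G) r" and sec: "\<And>x y. (x, y) \<in> r \<Longrightarrow> x \<in> secret G \<longleftrightarrow> y \<in> secret G"
    using ooe unfolding opaque_observation_equivalence_def by blast+
  have "r `` {x} \<in> secret (quotient_automaton G r) \<longleftrightarrow> x \<in> secret G"
  proof
    assume "r `` {x} \<in> secret (quotient_automaton G r)"
    then obtain x' where x': "x' \<in> secret G" "r `` {x} = r `` {x'}"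
      unfolding quotient_automaton_def by auto
    then have "(x', x) \<in> r" using equiv_class_self[OF eq x] by blast
    then show "x \<in> secret G" using sec x'(1) by blast
  next
    assume "x \<in> secret G"
    then show "r `` {x} \<in> secret (quotient_automaton G r)"
      unfolding quotient_automaton_def by auto
  qed
  then show ?thesis
    using x by (auto simp: nonsecret_def quotient_automaton_def quotientI)
qed

theorem theorem1:
  fixes G1 :: "('a, 'e) secret_automaton"
    and Gs :: "('b, 'e) secret_automaton list"
    and r :: "('a \<times> 'a) set"
  assumes "secret_automaton G1"
    and "\<And>G. G \<in> set Gs \<Longrightarrow> secret_automaton G"
    and "opaque_observation_equivalence G1 r"
  shows "current_state_opaque (sync_list G1 Gs) (secret_or G1 Gs) \<longleftrightarrow>
    current_state_opaque (sync_list (quotient_automaton G1 r) Gs)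
      (secret_or (quotient_automaton G1 r) Gs)"
proof -
  let ?Q = "quotient_automaton G1 r"
  let ?R = "lift_relation (class_graph (states G1) r) Gs"
  have G1: "automaton G1" and Gs: "\<And>G. G \<in> set Gs \<Longrightarrow> automaton G"
    using assms(1,2) by (auto simp: secret_automaton_def)
  have eq: "equiv (states G1) r"
    using assms(3) by (simp add: opaque_observation_equivalence_def)
  have fwd: "weak_simulation (sync_list G1 Gs) (sync_list ?Q Gs) ?R"
    using weak_simulation_sync_list[OF weak_simulation_quotient[OF G1 eq] Gs] .
  have bwd: "weak_simulation (sync_list ?Q Gs) (sync_list G1 Gs) (?R\<inverse>)"
    using weak_simulation_sync_list[OF weak_simulation_quotient_converse[OF G1 assms(3)] Gs]
    by (simp add: lift_relation_converse)
  \<comment> \<open>The lifted relation contains only tuples of states, so initial tuples must be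
    known to be such.\<close>
  have init: "initial G1 \<subseteq> states G1" "listset (map initial Gs) \<subseteq> listset (map states Gs)"
    using G1 Gs listset_map_mono[of Gs initial states] by (auto simp: automaton_def)
  have init_fwd: "\<exists>q \<in> initial (sync_list ?Q Gs). (p, q) \<in> ?R"
    if p: "p \<in> initial (sync_list G1 Gs)" for p
  proof -
    obtain x zs where "p = (x, zs)" "x \<in> initial G1" "zs \<in> listset (map initial Gs)"
      using p by (auto simp: initial_sync_list)
    then have "(r `` {x}, zs) \<in> initial (sync_list ?Q Gs)" "(p, (r `` {x}, zs)) \<in> ?R"
      using init by (auto simp: initial_sync_list lift_relation_def class_graph_def
          quotient_automaton_def)
    then show ?thesis by blast
  qed
  have init_bwd: "\<exists>p \<in> initial (sync_list G1 Gs). (p, q) \<in> ?R"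
    if q: "q \<in> initial (sync_list ?Q Gs)" for q
  proof -
    obtain x zs where "q = (r `` {x}, zs)" "x \<in> initial G1" "zs \<in> listset (map initial Gs)"
      using q by (auto simp: initial_sync_list quotient_automaton_def)
    then have "(x, zs) \<in> initial (sync_list G1 Gs)" "((x, zs), q) \<in> ?R"
      using init by (auto simp: initial_sync_list lift_relation_def class_graph_def)
    then show ?thesis by blast
  qed
  \<comment> \<open>Related tuples share the tail \<open>zs\<close>, so their secrecy could differ
    only in the first component, where \<open>x\<close> and its class agree.\<close>
  have secrets: "p \<in> secret_or G1 Gs \<longleftrightarrow> q \<in> secret_or ?Q Gs" if pq_R: "(p, q) \<in> ?R" for p q
  proof -
    obtain x zs where pq: "p = (x, zs)" "q = (r `` {x}, zs)" "x \<in> states G1"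
      using pq_R by (auto simp: lift_relation_def class_graph_def)
    moreover have "p \<in> states (sync_list G1 Gs)" "q \<in> states (sync_list ?Q Gs)"
      using pq_R fwd unfolding weak_simulation_def by blast+
    ultimately show ?thesis
      using nonsecret_quotient_iff[OF assms(3) pq(3)] by (auto simp: secret_or_def)
  qed
  show ?thesis
  proof
    assume "current_state_opaque (sync_list G1 Gs) (secret_or G1 Gs)"
    with current_state_opaque_transfer[OF fwd bwd init_fwd init_bwd secrets]
    show "current_state_opaque (sync_list ?Q Gs) (secret_or ?Q Gs)" by blast
  next
    assume op: "current_state_opaque (sync_list ?Q Gs) (secret_or ?Q Gs)"
    show "current_state_opaque (sync_list G1 Gs) (secret_or G1 Gs)"
      \<comment> \<open>The roles of the two systems are exchanged and the relation is the converse
        of \<open>?R\<close>, whose own converse is \<open>?R\<close> again, so \<open>fwd\<close>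
        serves as the backward simulation.\<close>
      by (rule current_state_opaque_transfer[OF bwd _ _ _ _ op])
        (use fwd init_fwd init_bwd secrets in auto)
  qed
qed

end
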